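(* Let $m,n\ge1$, let $G=G_{m\times n}$, let $d=\gcd(m+1,n+1)$ and let $u=(a,b)$ be a vertex of $G$ with $d\mid a$ or $d\mid b$. Then $(G,u)$ is an N-position in the Undirected Edge Geography game.
   Context: $G_{m\times n}=P_m\square P_n$ is the grid graph with vertex set $[m]\times[n]$, $(i,j)\sim(i',j')$ iff $|i-i'|+|j-j'|=1$. Undirected Edge Geography is a two-player game on a rooted graph: a position is $(H,v)$ with $v$ the root; a move chooses an edge of $H$ incident to $v$, deletes it, and makes its other endpoint the new root; players alternate and the first player unable to move loses. A position is an N-position if the player to move has a winning strategy, and a P-position otherwise. *)

theory Defs
  imports Main
begin

record 'a graph =
  gverts :: "'a set"
  gedges :: "'a set set"

definition grid_graph :: "nat \<Rightarrow> nat \<Rightarrow> (nat \<times> nat) graph" where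
  "grid_graph m n =
    \<lparr> gverts = {1..m} \<times> {1..n},
      gedges = {{(i, j), (i', j')} | i j i' j'.
        (i, j) \<in> {1..m} \<times> {1..n} \<and> (i', j') \<in> {1..m} \<times> {1..n} \<and>
        \<bar>int i - int i'\<bar> + \<bar>int j - int j'\<bar> = 1} \<rparr>"

definition delete_edge :: "'a graph \<Rightarrow> 'a set \<Rightarrow> 'a graph" where
  "delete_edge H e = H\<lparr> gedges := gedges H - {e} \<rparr>"

type_synonym 'a position = "'a graph \<times> 'a"

fun geo_move :: "'a position \<Rightarrow> 'a position \<Rightarrow> bool" where
  "geo_move (H, v) (H', v') \<longleftrightarrow> {v, v'} \<in> gedges H \<and> H' = delete_edge H {v, v'}"

text \<open>A partial play is the nonempty list of positions visited so far. The player who moves first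
  from the initial position is to move at the positions with even index, that is, after partial
  plays of odd length.\<close>

definition is_play :: "'a position \<Rightarrow> 'a position list \<Rightarrow> bool" where
  "is_play p ps \<longleftrightarrow> ps \<noteq> [] \<and> hd ps = p \<and> successively geo_move ps"

type_synonym 'a strategy = "'a position list \<Rightarrow> 'a position"

definition follows :: "'a strategy \<Rightarrow> 'a position list \<Rightarrow> bool" where
  "follows \<sigma> ps \<longleftrightarrow> (\<forall>k. even k \<and> Suc k < length ps \<longrightarrow> ps ! Suc k = \<sigma> (take (Suc k) ps))"

text \<open>Every move deletes an edge, so on a graph with finitely many edges every play ends, and it is
  lost by the player who cannot move. Hence a strategy of the first player is winning iff it
  prescribes a legal move whenever it is that player's turn. (On infinite graphs this condition
  would also count never-ending plays as won.)\<close>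

definition winning_strategy :: "'a position \<Rightarrow> 'a strategy \<Rightarrow> bool" where
  "winning_strategy p \<sigma> \<longleftrightarrow>
    (\<forall>ps. is_play p ps \<and> follows \<sigma> ps \<and> odd (length ps) \<longrightarrow> geo_move (last ps) (\<sigma> ps))"

definition N_position :: "'a position \<Rightarrow> bool" where
  "N_position p \<longleftrightarrow> (\<exists>\<sigma>. winning_strategy p \<sigma>)"

end

theory Submission
  imports Defs
begin

text \<open>
  Suppose that an independent vertex set \<open>T\<close> not containing the root \<open>u\<close> contains an odd number of
  neighbours of \<open>u\<close>, but an even number of neighbours of each other vertex outside \<open>T\<close>. The first
  player always moves into \<open>T\<close>; then all the parities are even, the opponent has to leave \<open>T\<close>, and
  the deleted edge restores the initial situation. Hence \<open>u\<close> is an N-position.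

  On the grid write \<open>M = m + 1\<close> and \<open>N = n + 1\<close>, and let \<open>d\<close> divide \<open>a\<close>, so that \<open>a = M r + N s\<close> with
  \<open>s \<ge> 0\<close>. In the plane, take a rectangle with diagonal sides and, inside it, all points of the
  colour opposite to that of its corners: every point of the plane except the four corners has an
  even number of neighbours in this set. The rectangle with corners
  \<open>(a, b)\<close>, \<open>(a - b, 0)\<close>, \<open>(M r, b + N s)\<close>, \<open>(M r - b, N s)\<close> has three corners on the lines
  \<open>i \<in> M \<int>\<close> and \<open>j \<in> N \<int>\<close>, which become invisible when the plane is folded onto the grid by
  reflection in these lines. The folded rectangle is the required set.
\<close>

section \<open>Winning strategies from invariants\<close>

text \<open>\<open>winning_strategy\<close> asks only for a legal move at each turn, so an invariant
  on plays suffices: choosing any successor in \<open>L\<close> keeps \<open>W\<close> at odd play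
  lengths and \<open>L\<close> at even ones.\<close>

lemma N_positionI:
  assumes "W p"
    and move: "\<And>q. W q \<Longrightarrow> \<exists>q'. geo_move q q' \<and> L q'"
    and reply: "\<And>q q'. L q \<Longrightarrow> geo_move q q' \<Longrightarrow> W q'"
  shows "N_position p"
proof -
  define \<sigma> where "\<sigma> ps = (SOME q'. geo_move (last ps) q' \<and> L q')" for ps :: "'a position list"
  have \<sigma>: "geo_move (last ps) (\<sigma> ps) \<and> L (\<sigma> ps)" if "W (last ps)" for ps
    unfolding \<sigma>_def by (rule someI_ex) (rule move[OF that])
  have "if odd (length ps) then W (last ps) else L (last ps)"
    if "is_play p ps" "follows \<sigma> ps" for ps
    using that
  proof (induction ps rule: rev_induct)
    case Nil
    then show ?case by (simp add: is_play_def)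
  next
    case (snoc q ps)
    show ?case
    proof (cases "ps = []")
      case True
      with snoc.prems \<open>W p\<close> show ?thesis by (simp add: is_play_def)
    next
      case False
      have play: "is_play p ps" and step: "geo_move (last ps) q"
        using snoc.prems False by (auto simp: is_play_def successively_append_iff)
      have "follows \<sigma> ps"
        unfolding follows_def
      proof (intro allI impI)
        fix k assume k: "even k \<and> Suc k < length ps"
        then have "(ps @ [q]) ! Suc k = \<sigma> (take (Suc k) (ps @ [q]))"
          using snoc.prems(2) by (simp add: follows_def)
        with k show "ps ! Suc k = \<sigma> (take (Suc k) ps)" by (simp add: nth_append)
      qed
      with snoc.IH play have IH: "if odd (length ps) then W (last ps) else L (last ps)" by blast
      show ?thesis
      proof (cases "odd (length ps)")
        case True
        then have "q = \<sigma> ps"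
          using snoc.prems(2)[unfolded follows_def, rule_format, of "length ps - 1"] False
          by (simp add: nth_append)
        with True IH \<sigma> show ?thesis by simp
      next
        case False
        with IH reply step show ?thesis by auto
      qed
    qed
  qed
  with \<sigma> have "winning_strategy p \<sigma>"
    unfolding winning_strategy_def by metis
  then show ?thesis by (auto simp: N_position_def)
qed

section \<open>Parity kernels\<close>

definition nbrs_in :: "'a graph \<Rightarrow> 'a set \<Rightarrow> 'a \<Rightarrow> 'a set" where
  "nbrs_in H T v = {w \<in> T. {v, w} \<in> gedges H}"

definition even_kernel :: "'a graph \<Rightarrow> 'a set \<Rightarrow> bool" where
  "even_kernel H T \<longleftrightarrow> finite T \<and> (\<forall>v\<in>T. nbrs_in H T v = {}) \<and>
    (\<forall>v. v \<notin> T \<longrightarrow> even (card (nbrs_in H T v)))"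

definition odd_kernel :: "'a graph \<Rightarrow> 'a set \<Rightarrow> 'a \<Rightarrow> bool" where
  "odd_kernel H T u \<longleftrightarrow> finite T \<and> (\<forall>v\<in>T. nbrs_in H T v = {}) \<and> u \<notin> T \<and>
    (\<forall>v. v \<notin> T \<longrightarrow> (odd (card (nbrs_in H T v)) \<longleftrightarrow> v = u))"

text \<open>With one end inside \<open>T\<close> and the other outside, the deleted edge is counted,
  among the vertices outside \<open>T\<close>, at \<open>u\<close> alone; so a move flips exactly
  one of the parities.\<close>

lemma nbrs_in_delete_edge:
  assumes "t \<in> T" "u \<notin> T"
  shows "v \<notin> T \<Longrightarrow> nbrs_in (delete_edge H {u, t}) T v =
      (if v = u then nbrs_in H T v - {t} else nbrs_in H T v)"
    and "nbrs_in (delete_edge H {u, t}) T v \<subseteq> nbrs_in H T v"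
  using assms by (auto simp: nbrs_in_def delete_edge_def doubleton_eq_iff)

lemma even_card_remove_iff:
  assumes "finite A" "x \<in> A"
  shows "even (card (A - {x})) \<longleftrightarrow> odd (card A)"
  using card_Suc_Diff1[OF assms] by (metis even_Suc)

lemma odd_kernel_move:
  assumes "odd_kernel H T u"
  obtains t where "t \<in> T" "{u, t} \<in> gedges H" "even_kernel (delete_edge H {u, t}) T"
proof -
  have T: "finite T" "\<forall>v\<in>T. nbrs_in H T v = {}" "u \<notin> T"
    and par: "\<And>v. v \<notin> T \<Longrightarrow> odd (card (nbrs_in H T v)) \<longleftrightarrow> v = u"
    using assms by (auto simp: odd_kernel_def)
  from par[OF \<open>u \<notin> T\<close>] have "nbrs_in H T u \<noteq> {}" by auto
  then obtain t where t: "t \<in> nbrs_in H T u" by auto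
  then have tT: "t \<in> T" and e: "{u, t} \<in> gedges H" by (auto simp: nbrs_in_def)
  have fin: "finite (nbrs_in H T u)" using T by (simp add: nbrs_in_def)
  have "even (card (nbrs_in (delete_edge H {u, t}) T v))" if "v \<notin> T" for v
    using par[OF that] even_card_remove_iff[OF fin t]
    by (auto simp: nbrs_in_delete_edge(1)[OF tT \<open>u \<notin> T\<close> that])
  then have "even_kernel (delete_edge H {u, t}) T"
    using T nbrs_in_delete_edge(2)[OF tT \<open>u \<notin> T\<close>, of H] unfolding even_kernel_def by blast
  with tT e that show ?thesis by blast
qed

lemma even_kernel_move:
  assumes "even_kernel H T" "t \<in> T" and e: "{t, u} \<in> gedges H"
  shows "odd_kernel (delete_edge H {t, u}) T u"
proof -
  have T: "finite T" "\<forall>v\<in>T. nbrs_in H T v = {}"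
    and par: "\<And>v. v \<notin> T \<Longrightarrow> even (card (nbrs_in H T v))"
    using assms by (auto simp: even_kernel_def)
  have u: "u \<notin> T" using T(2) e \<open>t \<in> T\<close> by (auto simp: nbrs_in_def)
  have t: "t \<in> nbrs_in H T u" using e \<open>t \<in> T\<close> by (simp add: nbrs_in_def insert_commute)
  have fin: "finite (nbrs_in H T u)" using T by (simp add: nbrs_in_def)
  have "odd (card (nbrs_in (delete_edge H {u, t}) T v)) \<longleftrightarrow> v = u" if "v \<notin> T" for v
    using par[OF that] even_card_remove_iff[OF fin t]
    by (auto simp: nbrs_in_delete_edge(1)[OF \<open>t \<in> T\<close> u that])
  then show ?thesis
    using T u nbrs_in_delete_edge(2)[OF \<open>t \<in> T\<close> u, of H]
    unfolding odd_kernel_def insert_commute[of t u] by blast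
qed

lemma N_position_if_odd_kernel:
  assumes "odd_kernel H T u"
  shows "N_position (H, u)"
proof (rule N_positionI[where W = "\<lambda>(H, v). odd_kernel H T v"
      and L = "\<lambda>(H, v). v \<in> T \<and> even_kernel H T"])
  show "case (H, u) of (H, v) \<Rightarrow> odd_kernel H T v" using assms by simp
next
  fix q assume "case q of (H, v) \<Rightarrow> odd_kernel H T v"
  then show "\<exists>q'. geo_move q q' \<and> (case q' of (H, v) \<Rightarrow> v \<in> T \<and> even_kernel H T)"
    by (cases q) (auto elim!: odd_kernel_move)
next
  fix q q' assume "case q of (H, v) \<Rightarrow> v \<in> T \<and> even_kernel H T" "geo_move q q'"
  then show "case q' of (H, v) \<Rightarrow> odd_kernel H T v"
    by (cases q; cases q') (auto intro: even_kernel_move)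
qed

section \<open>Unfolding by reflections\<close>

text \<open>As a function of \<open>i\<close>, this is the point mass at \<open>x\<close> unfolded to the integers by the
  reflections in the multiples of \<open>M\<close>. The signs are immaterial for parities, but they turn the
  congruences modulo 2 into identities.\<close>

definition unfolded :: "int \<Rightarrow> int \<Rightarrow> int \<Rightarrow> int" where
  "unfolded M x i = of_bool (2 * M dvd i - x) - of_bool (2 * M dvd i + x)"

text \<open>Both sides consist of the same four indicators. This discrete wave equation trades steps
  of the grid point for steps inside the rectangle.\<close>

lemma unfolded_wave:
  "unfolded M (x + 1) i + unfolded M (x - 1) i = unfolded M x (i + 1) + unfolded M x (i - 1)"
  by (simp add: unfolded_def algebra_simps)

lemma unfolded_eq_0:
  assumes "M dvd i \<or> M dvd x"
  shows "unfolded M x i = 0"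
proof -
  \<comment> \<open>The sum is \<open>2 * i\<close> and the difference is
    \<open>2 * x\<close>.\<close>
  have "2 * M dvd (i - x) + (i + x) \<or> 2 * M dvd (i + x) - (i - x)"
    using assms by auto
  then have "2 * M dvd i - x \<longleftrightarrow> 2 * M dvd i + x"
    by (metis add_diff_cancel_left' diff_add_cancel dvd_add dvd_diff)
  then show ?thesis by (simp add: unfolded_def)
qed

lemma unfolded_parity:
  assumes "unfolded M x i \<noteq> 0"
  shows "even (i - x)"
proof -
  have "2 * M dvd i - x \<or> 2 * M dvd i + x" using assms by (auto simp: unfolded_def)
  then have "even (i - x) \<or> even (i + x)" by (metis dvd_mult_left)
  then show ?thesis by simp
qed

lemma unfolded_inside:
  assumes "0 < x" "x < M" "0 < i" "i < M"
  shows "unfolded M x i = of_bool (x = i)"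
proof -
  have "\<not> 2 * M dvd i + x" using assms by (auto dest: zdvd_imp_le)
  moreover have "2 * M dvd i - x \<longleftrightarrow> x = i"
    using assms dvd_imp_le_int[of "i - x" "2 * M"] by fastforce
  ultimately show ?thesis by (simp add: unfolded_def)
qed

section \<open>The diagonal rectangle\<close>

text \<open>The summand is a mixed second difference up to sign, so it telescopes first in
  \<open>l\<close>, then in \<open>k\<close>, leaving the corners.\<close>

lemma rectangle_telescope:
  fixes h :: "nat \<Rightarrow> nat \<Rightarrow> int"
  shows "(\<Sum>k<K. \<Sum>l<L. h (Suc k) l + h k (Suc l) - h (Suc k) (Suc l) - h k l) =
    h K 0 + h 0 L - h K L - h 0 0"
proof -
  have "(\<Sum>l<L. h (Suc k) l + h k (Suc l) - h (Suc k) (Suc l) - h k l) =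
      (h (Suc k) 0 - h (Suc k) L) - (h k 0 - h k L)" for k
    by (induction L) (auto simp: algebra_simps)
  then show ?thesis
    using sum_lessThan_telescope[of "\<lambda>k. h k 0 - h k L" K] by simp
qed

lemma gcd_dvd_decompose:
  fixes a M N :: int
  assumes "gcd M N dvd a" "M > 0"
  obtains r and s :: nat where "a = M * r + N * int s"
proof -
  obtain p q where pq: "p * M + q * N = gcd M N" using bezout_int by blast
  obtain k where k: "a = gcd M N * k" using assms(1) by (auto elim: dvdE)
  \<comment> \<open>Reducing the Bezout coefficient of \<open>N\<close> modulo \<open>M\<close>
    makes it nonnegative, so that \<open>N * s\<close> can serve as a side length; the quotient is
    absorbed into \<open>r\<close>.\<close>
  define s where "s = nat ((q * k) mod M)"
  have s: "int s = (q * k) mod M" using \<open>M > 0\<close> by (simp add: s_def)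
  have "a = M * (p * k) + N * (q * k)" by (simp add: k flip: pq) (simp add: algebra_simps)
  also have "q * k = M * ((q * k) div M) + int s" by (simp add: s)
  finally have "a = M * (p * k + N * ((q * k) div M)) + N * int s" by (simp add: algebra_simps)
  then show ?thesis by (rule that)
qed

text \<open>The sum defining \<open>\<tau>\<close> below runs over the points of the rectangle whose colour is opposite to
  that of \<open>(a, b)\<close>; these are the centres of the unit diamonds that tile it.\<close>

lemma ex_potential_aux:
  fixes M N a :: int and b :: nat
  assumes "M > 0" "N > 0" "gcd M N dvd a"
  shows "\<exists>\<tau> :: int \<Rightarrow> int \<Rightarrow> int.
    (\<forall>x y. M dvd x \<or> N dvd y \<longrightarrow> \<tau> x y = 0) \<and>
    (\<forall>x y. \<tau> x y \<noteq> 0 \<longrightarrow> odd (a + int b + x + y)) \<and>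
    (\<forall>x y. \<tau> (x + 1) y + \<tau> (x - 1) y - \<tau> x (y + 1) - \<tau> x (y - 1) =
      unfolded M x a * unfolded N y (int b))"
proof -
  obtain r and s :: nat where rs: "a = M * r + N * int s"
    using gcd_dvd_decompose assms by blast
  define L where "L = nat (N * int s)"
  have L: "int L = N * int s" using \<open>N > 0\<close> by (simp add: L_def)
  define \<psi> where "\<psi> x y i j = unfolded M x i * unfolded N y j" for x y i j
  \<comment> \<open>From the corner \<open>(a - b, 0)\<close>, \<open>k\<close> runs up and to the
    right, \<open>l\<close> up and to the left; the \<open>+ 1\<close> leads from the lowest point
    of a unit diamond to its centre.\<close>
  define \<tau> where "\<tau> x y =
    (\<Sum>k<b. \<Sum>l<L. \<psi> x y (a - int b + int k - int l) (int k + int l + 1))" for x y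
  have "\<tau> x y = 0" if "M dvd x \<or> N dvd y" for x y
    using that unfolded_eq_0 by (auto simp: \<tau>_def \<psi>_def)
  moreover have "odd (a + int b + x + y)" if "\<tau> x y \<noteq> 0" for x y
  proof -
    have "\<exists>k l. \<psi> x y (a - int b + int k - int l) (int k + int l + 1) \<noteq> 0"
      using that by (rule contrapos_np) (auto simp: \<tau>_def)
    then obtain k l where "\<psi> x y (a - int b + int k - int l) (int k + int l + 1) \<noteq> 0"
      by blast
    then have "even (a - int b + int k - int l - x)" "even (int k + int l + 1 - y)"
      using unfolded_parity by (auto simp: \<psi>_def simp del: even_diff)
    then show ?thesis by auto
  qed
  moreover have "\<tau> (x + 1) y + \<tau> (x - 1) y - \<tau> x (y + 1) - \<tau> x (y - 1) =
      unfolded M x a * unfolded N y (int b)" for x y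
  proof -
    define h where "h k l = \<psi> x y (a - int b + int k - int l) (int k + int l)" for k l :: nat
    have wave: "\<psi> (x + 1) y i j + \<psi> (x - 1) y i j - \<psi> x (y + 1) i j - \<psi> x (y - 1) i j =
        \<psi> x y (i + 1) j + \<psi> x y (i - 1) j - \<psi> x y i (j + 1) - \<psi> x y i (j - 1)" for i j
    proof -
      have "\<psi> (x + 1) y i j + \<psi> (x - 1) y i j - \<psi> x (y + 1) i j - \<psi> x (y - 1) i j =
          (unfolded M (x + 1) i + unfolded M (x - 1) i) * unfolded N y j -
          unfolded M x i * (unfolded N (y + 1) j + unfolded N (y - 1) j)"
        by (simp add: \<psi>_def algebra_simps)
      then show ?thesis
        unfolding unfolded_wave by (simp add: \<psi>_def algebra_simps)
    qed
    have "\<tau> (x + 1) y + \<tau> (x - 1) y - \<tau> x (y + 1) - \<tau> x (y - 1) =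
        (\<Sum>k<b. \<Sum>l<L. h (Suc k) l + h k (Suc l) - h (Suc k) (Suc l) - h k l)"
      unfolding \<tau>_def sum.distrib[symmetric] sum_subtractf[symmetric] wave
      by (simp add: h_def algebra_simps)
    also have "\<dots> = h b 0 + h 0 L - h b L - h 0 0"
      by (rule rectangle_telescope)
    \<comment> \<open>The other three corners lie on mirror lines: \<open>h 0 0\<close> has second
      coordinate \<open>0\<close>, \<open>h 0 L\<close> has \<open>N * s\<close>, and
      \<open>h b L\<close> has first coordinate \<open>a - L = M * r\<close>.\<close>
    also have "\<dots> = h b 0"
      using L by (simp add: h_def \<psi>_def unfolded_eq_0 rs)
    also have "h b 0 = unfolded M x a * unfolded N y (int b)"
      by (simp add: h_def \<psi>_def)
    finally show ?thesis .
  qed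
  ultimately show ?thesis by blast
qed

text \<open>Modulo 2 the signs disappear, which makes the condition symmetric in the two
  coordinates; the case of \<open>b\<close> follows by transposition.\<close>

lemma ex_potential:
  fixes M N :: int and a b :: nat
  assumes "M > 0" "N > 0" "gcd M N dvd int a \<or> gcd M N dvd int b"
  obtains \<tau> :: "int \<Rightarrow> int \<Rightarrow> int"
  where "\<And>x y. M dvd x \<or> N dvd y \<Longrightarrow> \<tau> x y = 0"
    and "\<And>x y. \<tau> x y \<noteq> 0 \<Longrightarrow> odd (int a + int b + x + y)"
    and "\<And>x y. odd (\<tau> (x + 1) y + \<tau> (x - 1) y + \<tau> x (y + 1) + \<tau> x (y - 1)) \<longleftrightarrow>
      odd (unfolded M x (int a) * unfolded N y (int b))"
  using assms(3)
proof
  assume "gcd M N dvd int a"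
  then obtain \<tau> where "\<forall>x y. M dvd x \<or> N dvd y \<longrightarrow> \<tau> x y = 0"
      "\<forall>x y. \<tau> x y \<noteq> 0 \<longrightarrow> odd (int a + int b + x + y)"
      and *: "\<And>x y. \<tau> (x + 1) y + \<tau> (x - 1) y - \<tau> x (y + 1) - \<tau> x (y - 1) =
        unfolded M x (int a) * unfolded N y (int b)"
    using ex_potential_aux[OF \<open>M > 0\<close> \<open>N > 0\<close>, of "int a" b] by blast
  then show thesis by (intro that[of \<tau>]) (auto simp flip: *)
next
  assume "gcd M N dvd int b"
  then obtain \<tau> where "\<forall>x y. N dvd x \<or> M dvd y \<longrightarrow> \<tau> x y = 0"
      "\<forall>x y. \<tau> x y \<noteq> 0 \<longrightarrow> odd (int b + int a + x + y)"
      and *: "\<And>x y. \<tau> (x + 1) y + \<tau> (x - 1) y - \<tau> x (y + 1) - \<tau> x (y - 1) =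
        unfolded N x (int b) * unfolded M y (int a)"
    using ex_potential_aux[OF \<open>N > 0\<close> \<open>M > 0\<close>, of "int b" a] by (auto simp: gcd.commute)
  then show thesis
    by (intro that[of "\<lambda>x y. \<tau> y x"])
       (auto simp: ac_simps simp flip: *[unfolded mult.commute[of "unfolded N _ _"]])
qed

section \<open>Folding onto the grid\<close>

definition grid_nbrs :: "int \<Rightarrow> int \<Rightarrow> (int \<times> int) set" where
  "grid_nbrs x y = {(x + 1, y), (x - 1, y), (x, y + 1), (x, y - 1)}"

lemma mem_grid_nbrs: "(x', y') \<in> grid_nbrs x y \<longleftrightarrow> \<bar>x - x'\<bar> + \<bar>y - y'\<bar> = 1"
  by (auto simp: grid_nbrs_def)

lemma grid_edge_iff:
  "{(x, y), (x', y')} \<in> gedges (grid_graph m n) \<longleftrightarrow>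
    (x, y) \<in> {1..m} \<times> {1..n} \<and> (x', y') \<in> {1..m} \<times> {1..n} \<and>
    \<bar>int x - int x'\<bar> + \<bar>int y - int y'\<bar> = 1"
  unfolding grid_graph_def
  by (auto simp: doubleton_eq_iff abs_minus_commute)

text \<open>All points of the set have the colour opposite to \<open>(a, b)\<close>, hence it is
  independent and omits the root. As \<open>\<tau>\<close> vanishes on the lines bordering the grid,
  plane neighbours outside the grid do not affect the parities.\<close>

lemma grid_odd_kernel:
  fixes m n a b :: nat
  defines "M \<equiv> int m + 1" and "N \<equiv> int n + 1"
  assumes u: "(a, b) \<in> {1..m} \<times> {1..n}"
    and zero: "\<And>x y. M dvd x \<or> N dvd y \<Longrightarrow> \<tau> x y = 0"
    and parity: "\<And>x y. \<tau> x y \<noteq> 0 \<Longrightarrow> odd (int a + int b + x + y)"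
    and point: "\<And>x y. odd (\<tau> (x + 1) y + \<tau> (x - 1) y + \<tau> x (y + 1) + \<tau> x (y - 1)) \<longleftrightarrow>
      odd (unfolded M x (int a) * unfolded N y (int b))"
  shows "odd_kernel (grid_graph m n)
    {(x, y). (x, y) \<in> {1..m} \<times> {1..n} \<and> odd (\<tau> (int x) (int y))} (a, b)"
    (is "odd_kernel ?G ?T _")
proof -
  have T_parity: "odd (a + b + x + y)" if "(x, y) \<in> ?T" for x y
  proof -
    from that have "\<tau> (int x) (int y) \<noteq> 0" by auto
    from parity[OF this] show ?thesis by presburger
  qed
  have "?T \<subseteq> {1..m} \<times> {1..n}" by auto
  then have "finite ?T" by (rule finite_subset) simp
  moreover have "nbrs_in ?G ?T v = {}" if v: "v \<in> ?T" for v
  proof -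
    obtain x y where [simp]: "v = (x, y)" by fastforce
    have False if w: "(x', y') \<in> nbrs_in ?G ?T v" for x' y'
    proof -
      have w': "(x', y') \<in> ?T" and "\<bar>int x - int x'\<bar> + \<bar>int y - int y'\<bar> = 1"
        using w by (auto simp: nbrs_in_def grid_edge_iff)
      then have "odd (\<bar>int x - int x'\<bar> + \<bar>int y - int y'\<bar>)" by simp
      then have "odd (x + y + (x' + y'))" by auto
      with T_parity[of x y] T_parity[OF w'] v show False by auto
    qed
    then show ?thesis by auto
  qed
  moreover have "(a, b) \<notin> ?T" using T_parity[of a b] by fastforce
  moreover have "odd (card (nbrs_in ?G ?T v)) \<longleftrightarrow> v = (a, b)" for v
  proof (cases "v \<in> {1..m} \<times> {1..n}")
    case False
    then have "nbrs_in ?G ?T v = {}" by (cases v) (auto simp: nbrs_in_def grid_edge_iff)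
    with False u show ?thesis by auto
  next
    case True
    then obtain x y where v: "v = (x, y)" and xy: "1 \<le> x" "x \<le> m" "1 \<le> y" "y \<le> n" by auto
    let ?A = "grid_nbrs (int x) (int y)"
    let ?f = "\<lambda>(i, j). (nat i, nat j)"
    have "?f ` {p \<in> ?A. odd (\<tau> (fst p) (snd p))} = nbrs_in ?G ?T v"
    proof (intro equalityI subsetI)
      fix w assume "w \<in> ?f ` {p \<in> ?A. odd (\<tau> (fst p) (snd p))}"
      then obtain i j where ij: "(i, j) \<in> ?A" "odd (\<tau> i j)" "w = (nat i, nat j)" by auto
      from ij(2) zero[of i j] have "i \<noteq> 0" "i \<noteq> M" "j \<noteq> 0" "j \<noteq> N" by auto
      with ij(1) xy have "0 < i" "i < M" "0 < j" "j < N"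
        by (auto simp: grid_nbrs_def M_def N_def)
      with ij xy show "w \<in> nbrs_in ?G ?T v"
        by (auto simp: nbrs_in_def v grid_edge_iff mem_grid_nbrs M_def N_def)
    next
      fix w assume w: "w \<in> nbrs_in ?G ?T v"
      obtain x' y' where w': "w = (x', y')" by fastforce
      show "w \<in> ?f ` {p \<in> ?A. odd (\<tau> (fst p) (snd p))}"
        using w unfolding w' v
        by (intro image_eqI[where x = "(int x', int y')"])
           (auto simp: nbrs_in_def grid_edge_iff mem_grid_nbrs)
    qed
    \<comment> \<open>The neighbours of a grid point have nonnegative coordinates, where
      \<open>nat\<close> is injective.\<close>
    moreover have "inj_on ?f ?A"
      using xy by (auto simp: grid_nbrs_def inj_on_def)
    ultimately have "card (nbrs_in ?G ?T v) = card {p \<in> ?A. odd (\<tau> (fst p) (snd p))}"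
      by (metis (no_types, lifting) card_image inj_on_subset mem_Collect_eq subsetI)
    \<comment> \<open>A sum of integers has the parity of its number of odd terms.\<close>
    then have "odd (card (nbrs_in ?G ?T v)) \<longleftrightarrow> odd (\<Sum>p\<in>?A. \<tau> (fst p) (snd p))"
      by (simp add: even_sum_iff grid_nbrs_def del: sum.insert)
    also have "\<dots> \<longleftrightarrow> odd (unfolded M (int x) (int a) * unfolded N (int y) (int b))"
      unfolding point[symmetric] by (simp add: grid_nbrs_def add.assoc)
    also have "\<dots> \<longleftrightarrow> v = (a, b)"
      using u xy by (simp add: unfolded_inside M_def N_def v)
    finally show ?thesis .
  qed
  ultimately show ?thesis unfolding odd_kernel_def by blast
qed

theorem theorem2p4:
  fixes m n d a b :: nat and G :: "(nat \<times> nat) graph" and u :: "nat \<times> nat"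
  assumes "m \<ge> 1" and "n \<ge> 1"
    and "G = grid_graph m n"
    and "d = gcd (m + 1) (n + 1)"
    and "u = (a, b)" and "u \<in> gverts G"
    and "d dvd a \<or> d dvd b"
  shows "N_position (G, u)"
proof -
  have "int d = gcd (int m + 1) (int n + 1)"
    using \<open>d = _\<close> by (metis gcd_int_int_eq of_nat_1 of_nat_add)
  with \<open>d dvd a \<or> d dvd b\<close>
  have dvd: "gcd (int m + 1) (int n + 1) dvd int a \<or> gcd (int m + 1) (int n + 1) dvd int b"
    by (metis int_dvd_int_iff)
  have ab: "(a, b) \<in> {1..m} \<times> {1..n}"
    using assms by (simp add: grid_graph_def)
  have "\<exists>T. odd_kernel (grid_graph m n) T (a, b)"
  proof (rule ex_potential[OF _ _ dvd])
    show "\<exists>T. odd_kernel (grid_graph m n) T (a, b)"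
      if "\<And>x y. int m + 1 dvd x \<or> int n + 1 dvd y \<Longrightarrow> \<tau> x y = 0"
        and "\<And>x y. \<tau> x y \<noteq> 0 \<Longrightarrow> odd (int a + int b + x + y)"
        and "\<And>x y. odd (\<tau> (x + 1) y + \<tau> (x - 1) y + \<tau> x (y + 1) + \<tau> x (y - 1)) \<longleftrightarrow>
          odd (unfolded (int m + 1) x (int a) * unfolded (int n + 1) y (int b))"
      for \<tau>
      using grid_odd_kernel[OF ab that] by blast
  qed simp_all
  then show ?thesis
    using assms by (auto intro: N_position_if_odd_kernel)
qed

end
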